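(* For every positive integer $n$, the digraphs $\vec{C}_3(n,n,n)$ and $\vec{C}_3(n,n,n+1)$ are DHS, and for every integer $n\ge 2$, the digraph $\vec{C}_3(n-1,n,n)$ is DHS.
   Context: A mixed graph $D$ is obtained from a finite simple undirected graph by orienting a subset of its edges; each edge is either undirected or an arc in exactly one direction. Its Hermitian adjacency matrix $H(D)\in\mathbb{C}^{V\times V}$, $V=V(D)$, has $(u,v)$-entry $1$ if $uv$ is an undirected edge, $i$ (imaginary unit) if there is an arc from $u$ to $v$, $-i$ if there is an arc from $v$ to $u$, and $0$ otherwise. Two mixed graphs are $H$-cospectral if their Hermitian adjacency matrices have the same eigenvalues with the same multiplicities. Let $\mathcal{S}$ be the set of diagonal matrices indexed by $V$ with all diagonal entries in $\{1,-1,i,-i\}$. A mixed graph $D'$ on the vertex set $V(D)$ is obtained from $D$ by a four-way switching if $H(D')=S^{-1}H(D)S$ for some $S\in\mathcal{S}$. A mixed graph $D$ is determined by its Hermitian spectrum (DHS) if every mixed graph that is $H$-cospectral with $D$ is isomorphic to a mixed graph that can be obtained from $D$ by a four-way switching, possibly followed by the reversal of all directed edges. For positive integers $a,b,c$, $\vec{C}_3(a,b,c)$ is the complete tripartite mixed graph with parts $A,B,C$, $|A|=a$, $|B|=b$, $|C|=c$, having all arcs from $A$ to $B$, all arcs from $B$ to $C$, and all arcs from $C$ to $A$ (and no other edges). *)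

theory Defs
  imports Complex_Main "Jordan_Normal_Form.Char_Poly"
begin

record 'a mixed_graph =
  verts :: "'a set"
  edges :: "'a set set"
  arcs :: "('a \<times> 'a) set"

text \<open>
  \<open>edges\<close> holds the edges left undirected and \<open>arcs\<close> the oriented ones; the last two conditions
  say that each edge of the underlying simple graph is of one kind and has at most one direction.
\<close>
definition mixed_graph :: "'a mixed_graph \<Rightarrow> bool" where
  "mixed_graph D \<longleftrightarrow>
     finite (verts D) \<and>
     (\<forall>e \<in> edges D. e \<subseteq> verts D \<and> card e = 2) \<and>
     (\<forall>(u, v) \<in> arcs D. u \<in> verts D \<and> v \<in> verts D \<and> u \<noteq> v) \<and>
     (\<forall>(u, v) \<in> arcs D. (v, u) \<notin> arcs D) \<and>
     (\<forall>(u, v) \<in> arcs D. {u, v} \<notin> edges D)"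

definition reversal :: "'a mixed_graph \<Rightarrow> 'a mixed_graph" where
  "reversal D = D\<lparr>arcs := (arcs D)\<inverse>\<rparr>"

definition isomorphic :: "'a mixed_graph \<Rightarrow> 'b mixed_graph \<Rightarrow> bool" where
  "isomorphic D D' \<longleftrightarrow>
     (\<exists>f. bij_betw f (verts D) (verts D') \<and>
       (\<forall>u \<in> verts D. \<forall>v \<in> verts D.
          ({u, v} \<in> edges D \<longleftrightarrow> {f u, f v} \<in> edges D') \<and>
          ((u, v) \<in> arcs D \<longleftrightarrow> (f u, f v) \<in> arcs D')))"

text \<open>
  Library matrices are indexed by an initial segment of the naturals. A \<open>V\<close>-indexed matrix is
  represented through an enumeration of \<open>V\<close>, chosen once and for all and depending only on \<open>V\<close>,
  so that matrices of two graphs on the same vertex set are directly comparable. Spectra do not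
  depend on the choice.
\<close>
definition vertex_list :: "'a set \<Rightarrow> 'a list" where
  "vertex_list V = (SOME xs. distinct xs \<and> set xs = V)"

definition hermitian_entry :: "'a mixed_graph \<Rightarrow> 'a \<Rightarrow> 'a \<Rightarrow> complex" where
  "hermitian_entry D u v =
     (if {u, v} \<in> edges D then 1
      else if (u, v) \<in> arcs D then \<i>
      else if (v, u) \<in> arcs D then - \<i>
      else 0)"

definition hermitian_adj :: "'a mixed_graph \<Rightarrow> complex mat" where
  "hermitian_adj D =
     mat (card (verts D)) (card (verts D))
       (\<lambda>(i, j). hermitian_entry D (vertex_list (verts D) ! i) (vertex_list (verts D) ! j))"

text \<open>
  The order of \<open>z\<close> as a root of the characteristic polynomial is the multiplicity of \<open>z\<close> as an
  eigenvalue, and is \<open>0\<close> exactly when \<open>z\<close> is not an eigenvalue.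
\<close>
definition H_cospectral :: "'a mixed_graph \<Rightarrow> 'b mixed_graph \<Rightarrow> bool" where
  "H_cospectral D D' \<longleftrightarrow>
     (\<forall>z. order z (char_poly (hermitian_adj D)) = order z (char_poly (hermitian_adj D')))"

definition switching_matrices :: "nat \<Rightarrow> complex mat set" where
  "switching_matrices n =
     {S \<in> carrier_mat n n. diagonal_mat S \<and> (\<forall>i < n. S $$ (i, i) \<in> {1, -1, \<i>, - \<i>})}"

text \<open>\<open>similar_mat_wit A B T S\<close> says that \<open>T\<close> is the inverse of \<open>S\<close> and \<open>A = T * B * S\<close>.\<close>
definition four_way_switching :: "'a mixed_graph \<Rightarrow> 'a mixed_graph \<Rightarrow> bool" where
  "four_way_switching D D' \<longleftrightarrow>
     mixed_graph D' \<and> verts D' = verts D \<and>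
     (\<exists>S \<in> switching_matrices (card (verts D)). \<exists>T.
        similar_mat_wit (hermitian_adj D') (hermitian_adj D) T S)"

text \<open>
  The cospectral mates range over all mixed graphs with vertices in the type \<open>'b\<close>, which is
  independent of the vertex type of \<open>D\<close>.
\<close>
definition DHS :: "'b itself \<Rightarrow> 'a mixed_graph \<Rightarrow> bool" where
  "DHS TYPE('b) D \<longleftrightarrow>
     mixed_graph D \<and>
     (\<forall>D' :: 'b mixed_graph. mixed_graph D' \<and> H_cospectral D' D \<longrightarrow>
        (\<exists>D''. four_way_switching D D'' \<and> (isomorphic D' D'' \<or> isomorphic D' (reversal D''))))"

definition is_C3 :: "nat \<Rightarrow> nat \<Rightarrow> nat \<Rightarrow> 'a mixed_graph \<Rightarrow> bool" where
  "is_C3 a b c D \<longleftrightarrow>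
     (\<exists>A B C. finite A \<and> finite B \<and> finite C \<and>
        A \<inter> B = {} \<and> B \<inter> C = {} \<and> C \<inter> A = {} \<and>
        card A = a \<and> card B = b \<and> card C = c \<and>
        D = \<lparr>verts = A \<union> B \<union> C, edges = {}, arcs = A \<times> B \<union> B \<times> C \<union> C \<times> A\<rparr>)"

end

theory Submission
  imports Defs "Jordan_Normal_Form.Schur_Decomposition"
begin

text \<open>
  Let \<open>D'\<close> be cospectral with \<open>C\<^sub>3(a, b, c)\<close> and put \<open>m = a b + b c + c a\<close>. Equal spectra give equal
  traces of powers, and \<open>H(C\<^sub>3)\<^sup>3 = m H(C\<^sub>3)\<close>, so for \<open>H = H(D')\<close> the traces of \<open>H\<^sup>2, H\<^sup>4, H\<^sup>6\<close>
  force \<open>H\<^sup>3 = m H\<close>, and \<open>H\<close> has rank \<open>2\<close>. Hence \<open>H\<close> is recovered from the two rows of any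
  edge \<open>u w\<close>. The vertices not isolated fall into three classes, according to whether they are
  adjacent to \<open>u\<close>, to \<open>w\<close>, or to both, and \<open>D'\<close> is, up to switching, some \<open>C\<^sub>3(a', b', c')\<close> with
  isolated vertices added, where \<open>a' b' + b' c' + c' a' = m\<close> and \<open>a' + b' + c' \<le> a + b + c\<close>. For
  balanced \<open>a, b, c\<close> the value \<open>m\<close> is the Turan maximum, so there are no isolated vertices and the
  sizes agree up to rotation.
\<close>

section \<open>Traces of powers and the spectrum\<close>

definition mat_trace :: "'a :: comm_ring_1 mat \<Rightarrow> 'a" where
  "mat_trace A = (\<Sum>i<dim_row A. A $$ (i, i))"

lemma mult_mat_entry:
  assumes "A \<in> carrier_mat n k" "B \<in> carrier_mat k m" "i < n" "j < m"
  shows "(A * B) $$ (i, j) = (\<Sum>l<k. A $$ (i, l) * B $$ (l, j))"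
  using assms by (simp add: scalar_prod_def atLeast0LessThan)

lemma mat_trace_mult:
  assumes "A \<in> carrier_mat n k" "B \<in> carrier_mat k n"
  shows "mat_trace (A * B) = (\<Sum>i<n. \<Sum>l<k. A $$ (i, l) * B $$ (l, i))"
  using assms by (simp add: mat_trace_def scalar_prod_def atLeast0LessThan)

lemma mat_trace_mult_commute:
  fixes A B :: "'a :: comm_ring_1 mat"
  assumes "A \<in> carrier_mat n k" "B \<in> carrier_mat k n"
  shows "mat_trace (A * B) = mat_trace (B * A)"
  unfolding mat_trace_mult[OF assms] mat_trace_mult[OF assms(2,1)]
  by (subst sum.swap) (simp add: mult.commute)

lemma mat_trace_similar:
  fixes A B :: "'a :: comm_ring_1 mat"
  assumes "similar_mat_wit A B P Q"
  shows "mat_trace A = mat_trace B"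
proof -
  obtain n where "n = dim_row A" by simp
  note D = similar_mat_witD[OF this assms]
  have "mat_trace A = mat_trace (P * (B * Q))"
    unfolding D(3) by (subst assoc_mult_mat[OF D(6,5,7)]) simp
  also have "\<dots> = mat_trace (B * Q * P)"
    using D(5-7) by (intro mat_trace_mult_commute) auto
  also have "B * Q * P = B"
    using D(5) by (subst assoc_mult_mat[OF D(5,7,6)]) (simp add: D(2))
  finally show ?thesis .
qed

lemma pow_mat_add:
  fixes A :: "'a :: semiring_1 mat"
  assumes "A \<in> carrier_mat n n"
  shows "A ^\<^sub>m (k + l) = A ^\<^sub>m k * A ^\<^sub>m l"
proof (induction l)
  case (Suc l)
  have "A ^\<^sub>m (k + l) * A = A ^\<^sub>m k * (A ^\<^sub>m l * A)"
    unfolding Suc using assms by (intro assoc_mult_mat) auto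
  then show ?case by simp
qed (use assms in auto)

lemma upper_triangular_pow:
  fixes A :: "'a :: comm_ring_1 mat"
  assumes A: "A \<in> carrier_mat n n" and ut: "upper_triangular A"
  shows "upper_triangular (A ^\<^sub>m k)" and "i < n \<Longrightarrow> (A ^\<^sub>m k) $$ (i, i) = (A $$ (i, i)) ^ k"
proof -
  have "upper_triangular (A ^\<^sub>m k) \<and> (\<forall>i<n. (A ^\<^sub>m k) $$ (i, i) = (A $$ (i, i)) ^ k)"
  proof (induction k)
    case 0
    then show ?case using A by auto
  next
    case (Suc k)
    have P: "A ^\<^sub>m k \<in> carrier_mat n n" using A by auto
    have z: "(A ^\<^sub>m k) $$ (i, l) * A $$ (l, j) = 0" if "i < n" "l < n" "j < n" "l < i \<or> j < l" for i l j
      using that Suc ut A P unfolding upper_triangular_def by auto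
    have "(A ^\<^sub>m Suc k) $$ (i, j) = 0" if "j < i" "i < n" for i j
      using that by (simp add: mult_mat_entry[OF P A], intro sum.neutral) (auto intro!: z)
    moreover have "(A ^\<^sub>m Suc k) $$ (i, i) = (A $$ (i, i)) ^ Suc k" if "i < n" for i
    proof -
      have "(A ^\<^sub>m Suc k) $$ (i, i) = (\<Sum>l<n. (A ^\<^sub>m k) $$ (i, l) * A $$ (l, i))"
        using that by (simp add: mult_mat_entry[OF P A])
      also have "\<dots> = (\<Sum>l\<in>{i}. (A ^\<^sub>m k) $$ (i, l) * A $$ (l, i))"
        using that by (intro sum.mono_neutral_right) (auto intro!: z)
      finally show ?thesis using that Suc by (simp add: mult.commute)
    qed
    ultimately show ?case using A by auto
  qed
  then show "upper_triangular (A ^\<^sub>m k)" "i < n \<Longrightarrow> (A ^\<^sub>m k) $$ (i, i) = (A $$ (i, i)) ^ k"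
    by auto
qed

text \<open>Schur decomposition gives a similar upper triangular \<open>B\<close> with diagonal
  \<open>es\<close>. The trace of a power is invariant under similarity, and the diagonal of
  \<open>B ^\<^sub>m k\<close> consists of the \<open>k\<close>-th powers of the diagonal of
  \<open>B\<close>.\<close>

lemma mat_trace_pow_eigenvalues:
  fixes A :: "complex mat"
  assumes A: "A \<in> carrier_mat n n" and c: "char_poly A = (\<Prod>e\<leftarrow>es. [:- e, 1:])"
  shows "mat_trace (A ^\<^sub>m k) = (\<Sum>e\<leftarrow>es. e ^ k)"
proof -
  obtain B P Q where S: "schur_decomposition A es = (B, P, Q)"
    by (metis prod_cases3)
  note sd = schur_decomposition[OF A c S]
  then have wit: "similar_mat_wit A B P Q" and ut: "upper_triangular B" and d: "diag_mat B = es"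
    by auto
  have B: "B \<in> carrier_mat n n"
    using similar_mat_witD2[OF A wit] by auto
  have "mat_trace (A ^\<^sub>m k) = mat_trace (B ^\<^sub>m k)"
    by (rule mat_trace_similar[OF similar_mat_wit_pow[OF wit]])
  also have "\<dots> = (\<Sum>i<n. (B $$ (i, i)) ^ k)"
    using B upper_triangular_pow(2)[OF B ut] by (simp add: mat_trace_def)
  also have "\<dots> = (\<Sum>e\<leftarrow>es. e ^ k)"
    using B unfolding d[symmetric] diag_mat_def
    by (simp add: comp_def interv_sum_list_conv_sum_set_nat atLeast0LessThan)
  finally show ?thesis .
qed

text \<open>Translates the orders of roots that define cospectrality into a multiset of
  eigenvalues.\<close>

lemma order_prod_linear:
  fixes z :: "'a :: field"
  shows "Polynomial.order z (\<Prod>a\<leftarrow>as. [:- a, 1:]) = count (mset as) z"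
proof (induction as)
  case (Cons a as)
  have "(\<Prod>a\<leftarrow>bs. [:- a, 1:]) \<noteq> 0" for bs :: "'a list"
    by (induction bs) (simp_all del: mult_pCons_left mult_pCons_right)
  from this[of "a # as"] have "Polynomial.order z (\<Prod>a\<leftarrow>a # as. [:- a, 1:]) =
      Polynomial.order z [:- a, 1:] + Polynomial.order z (\<Prod>a\<leftarrow>as. [:- a, 1:])"
    unfolding list.map prod_list.Cons by (rule Polynomial.order_mult)
  also have "Polynomial.order z [:- a, 1:] = (if z = a then 1 else 0)"
    using order_linear_power[of z "- a" 1] by auto
  finally show ?case
    using Cons by simp
qed (simp add: order_1_eq_0)

text \<open>Over the complex numbers both characteristic polynomials split, so equal orders mean
  equal multisets of roots. The size of that multiset is the dimension, and its power sums are the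
  traces.\<close>

lemma same_orders_same_trace_pow:
  fixes A B :: "complex mat"
  assumes A: "A \<in> carrier_mat n n" and B: "B \<in> carrier_mat n' n'"
    and ord: "\<And>z. Polynomial.order z (char_poly A) = Polynomial.order z (char_poly B)"
  shows "n = n'" and "mat_trace (A ^\<^sub>m k) = mat_trace (B ^\<^sub>m k)"
proof -
  obtain as where as: "char_poly A = (\<Prod>a\<leftarrow>as. [:- a, 1:])" "length as = n"
    using char_poly_factorized[OF A] by auto
  obtain bs where bs: "char_poly B = (\<Prod>a\<leftarrow>bs. [:- a, 1:])" "length bs = n'"
    using char_poly_factorized[OF B] by auto
  have eq: "mset as = mset bs"
    using ord unfolding as bs order_prod_linear by (intro multiset_eqI) auto
  then show "n = n'"
    using as bs size_mset by metis
  have "sum_mset (image_mset (\<lambda>e. e ^ k) (mset as)) = sum_mset (image_mset (\<lambda>e. e ^ k) (mset bs))"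
    by (simp add: eq)
  then show "mat_trace (A ^\<^sub>m k) = mat_trace (B ^\<^sub>m k)"
    unfolding mat_trace_pow_eigenvalues[OF A as(1)] mat_trace_pow_eigenvalues[OF B bs(1)]
    by (simp flip: mset_map add: sum_mset_sum_list)
qed

section \<open>The identity \<open>H\<^sup>3 = m H\<close> from three traces\<close>

lemma hermitian_pow_entry:
  fixes M :: "complex mat"
  assumes M: "M \<in> carrier_mat n n" and herm: "\<And>i j. i < n \<Longrightarrow> j < n \<Longrightarrow> M $$ (j, i) = cnj (M $$ (i, j))"
    and ij: "i < n" "j < n"
  shows "(M ^\<^sub>m k) $$ (j, i) = cnj ((M ^\<^sub>m k) $$ (i, j))"
  using ij
proof (induction k arbitrary: i j)
  case 0
  then show ?case using M by auto
next
  case (Suc k)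
  have P: "M ^\<^sub>m k \<in> carrier_mat n n" using M by auto
  \<comment> \<open>Conjugate transposition reverses products, so the factor split off on the right
    reappears on the left.\<close>
  have comm: "M ^\<^sub>m Suc k = M * M ^\<^sub>m k"
    using pow_mat_add[OF M, of 1 k] M by simp
  have "(M ^\<^sub>m Suc k) $$ (j, i) = (\<Sum>l<n. cnj (M $$ (i, l)) * cnj ((M ^\<^sub>m k) $$ (l, j)))"
    using Suc.prems by (auto simp: mult_mat_entry[OF P M] mult.commute Suc.IH[of _ j] herm[of i] intro!: sum.cong)
  also have "\<dots> = cnj ((M ^\<^sub>m Suc k) $$ (i, j))"
    unfolding comm using Suc.prems by (simp add: mult_mat_entry[OF M P])
  finally show ?case .
qed

text \<open>The three trace conditions say that \<open>M\<^sup>3 - m M\<close>, which is Hermitian, has Frobenius norm \<open>0\<close>.\<close>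
lemma hermitian_cube_from_traces:
  fixes M :: "complex mat"
  assumes M: "M \<in> carrier_mat n n" and herm: "\<And>i j. i < n \<Longrightarrow> j < n \<Longrightarrow> M $$ (j, i) = cnj (M $$ (i, j))"
    and tr: "mat_trace (M ^\<^sub>m 2) = 2 * of_nat m" "mat_trace (M ^\<^sub>m 4) = 2 * of_nat m ^ 2"
      "mat_trace (M ^\<^sub>m 6) = 2 * of_nat m ^ 3"
    and ij: "i < n" "j < n"
  shows "(M ^\<^sub>m 3) $$ (i, j) = of_nat m * M $$ (i, j)"
proof -
  have M3: "M ^\<^sub>m 3 \<in> carrier_mat n n" using M by auto
  define X where "X i j = (M ^\<^sub>m 3) $$ (i, j) - of_nat m * M $$ (i, j)" for i j
  have X: "X j i = cnj (X i j)" if "i < n" "j < n" for i j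
    using hermitian_pow_entry[OF M herm that, of 3] herm[OF that] by (simp add: X_def)
  have tr6: "(\<Sum>i<n. \<Sum>j<n. (M ^\<^sub>m 3) $$ (i, j) * (M ^\<^sub>m 3) $$ (j, i)) = 2 * of_nat m ^ 3"
    using mat_trace_mult[OF M3 M3] pow_mat_add[OF M, of 3 3] tr by simp
  have tr4: "(\<Sum>i<n. \<Sum>j<n. (M ^\<^sub>m 3) $$ (i, j) * M $$ (j, i)) = 2 * of_nat m ^ 2"
    using mat_trace_mult[OF M3 M] pow_mat_add[OF M, of 3 1] M tr by simp
  have tr4': "(\<Sum>i<n. \<Sum>j<n. M $$ (i, j) * (M ^\<^sub>m 3) $$ (j, i)) = 2 * of_nat m ^ 2"
    using mat_trace_mult[OF M M3] pow_mat_add[OF M, of 1 3] M tr by simp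
  have tr2: "(\<Sum>i<n. \<Sum>j<n. M $$ (i, j) * M $$ (j, i)) = 2 * of_nat m"
    using mat_trace_mult[OF M M] pow_mat_add[OF M, of 1 1] M tr by (simp add: numeral_2_eq_2)
  \<comment> \<open>This is the trace of \<open>X\<^sup>2\<close>; the known traces turn it into
    \<open>2 m\<^sup>3 - 2 m\<^sup>3 - 2 m\<^sup>3 + 2 m\<^sup>3\<close>. As \<open>X\<close> is
    Hermitian, it is also the sum of the squared moduli of the entries.\<close>
  have "(\<Sum>i<n. \<Sum>j<n. X i j * X j i) =
      (\<Sum>i<n. \<Sum>j<n. (M ^\<^sub>m 3) $$ (i, j) * (M ^\<^sub>m 3) $$ (j, i))
      - of_nat m * (\<Sum>i<n. \<Sum>j<n. (M ^\<^sub>m 3) $$ (i, j) * M $$ (j, i))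
      - of_nat m * (\<Sum>i<n. \<Sum>j<n. M $$ (i, j) * (M ^\<^sub>m 3) $$ (j, i))
      + of_nat m ^ 2 * (\<Sum>i<n. \<Sum>j<n. M $$ (i, j) * M $$ (j, i))"
    unfolding X_def by (simp add: algebra_simps sum.distrib sum_subtractf sum_distrib_left power2_eq_square)
  also have "\<dots> = 0"
    unfolding tr6 tr4 tr4' tr2 by (simp add: algebra_simps power2_eq_square power3_eq_cube)
  finally have "(\<Sum>i<n. \<Sum>j<n. X i j * X j i) = 0" .
  moreover have "X i j * X j i = of_real ((cmod (X i j))\<^sup>2)" if "i < n" "j < n" for i j
    by (simp add: X[OF that] complex_norm_square del: of_real_power)
  ultimately have "complex_of_real (\<Sum>i<n. \<Sum>j<n. (cmod (X i j))\<^sup>2) = 0"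
    by (simp del: of_real_power)
  then have "(\<Sum>i<n. \<Sum>j<n. (cmod (X i j))\<^sup>2) = 0"
    using of_real_eq_0_iff by blast
  then have "(\<Sum>j<n. (cmod (X i j))\<^sup>2) = 0"
    using ij by (subst (asm) sum_nonneg_eq_0_iff) (auto intro: sum_nonneg)
  then have "X i j = 0"
    using ij by (subst (asm) sum_nonneg_eq_0_iff) auto
  then show ?thesis by (simp add: X_def)
qed

section \<open>Hermitian matrices of rank two\<close>

text \<open>For a Hermitian idempotent, \<open>P x x\<close> is the squared norm of row
  \<open>x\<close>, so the trace is the sum of the squared moduli of all entries.\<close>

lemma hermitian_projection_trace_zero:
  fixes P :: "'a \<Rightarrow> 'a \<Rightarrow> complex"
  assumes fin: "finite V"
    and herm: "\<And>x y. x \<in> V \<Longrightarrow> y \<in> V \<Longrightarrow> P y x = cnj (P x y)"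
    and idem: "\<And>x y. x \<in> V \<Longrightarrow> y \<in> V \<Longrightarrow> (\<Sum>z\<in>V. P x z * P z y) = P x y"
    and tr: "(\<Sum>x\<in>V. P x x) = 0"
    and xy: "x \<in> V" "y \<in> V"
  shows "P x y = 0"
proof -
  have "complex_of_real (\<Sum>z\<in>V. (cmod (P x z))\<^sup>2) = P x x" if "x \<in> V" for x
  proof -
    have "(\<Sum>z\<in>V. P x z * P z x) = (\<Sum>z\<in>V. complex_of_real ((cmod (P x z))\<^sup>2))"
      using that by (intro sum.cong refl) (simp add: herm[of x] complex_norm_square del: of_real_power)
    then show ?thesis using idem[OF that that] by simp
  qed
  then have "complex_of_real (\<Sum>x\<in>V. \<Sum>z\<in>V. (cmod (P x z))\<^sup>2) = 0"
    using tr by simp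
  then have "(\<Sum>x\<in>V. \<Sum>z\<in>V. (cmod (P x z))\<^sup>2) = 0"
    using of_real_eq_0_iff by blast
  then have "(\<Sum>z\<in>V. (cmod (P x z))\<^sup>2) = 0"
    using xy fin by (subst (asm) sum_nonneg_eq_0_iff) (auto intro: sum_nonneg)
  then show ?thesis
    using xy fin by (subst (asm) sum_nonneg_eq_0_iff) auto
qed

text \<open>Column \<open>c\<close> lies in the range of \<open>P\<close> and has squared norm
  \<open>P c c\<close>. The subtracted term is the orthogonal projection onto its span, so
  \<open>Q\<close> projects onto the rest of the range and the trace drops by one.\<close>

lemma hermitian_projection_deflate:
  fixes P :: "'a \<Rightarrow> 'a \<Rightarrow> complex"
  assumes herm: "\<And>x y. x \<in> V \<Longrightarrow> y \<in> V \<Longrightarrow> P y x = cnj (P x y)"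
    and idem: "\<And>x y. x \<in> V \<Longrightarrow> y \<in> V \<Longrightarrow> (\<Sum>z\<in>V. P x z * P z y) = P x y"
    and c: "c \<in> V" "P c c \<noteq> 0"
  defines "Q \<equiv> \<lambda>x y. P x y - P x c * P c y / P c c"
  shows "\<And>x y. x \<in> V \<Longrightarrow> y \<in> V \<Longrightarrow> Q y x = cnj (Q x y)"
    and "\<And>x y. x \<in> V \<Longrightarrow> y \<in> V \<Longrightarrow> (\<Sum>z\<in>V. Q x z * Q z y) = Q x y"
    and "(\<Sum>x\<in>V. Q x x) = (\<Sum>x\<in>V. P x x) - 1"
proof -
  show "Q y x = cnj (Q x y)" if "x \<in> V" "y \<in> V" for x y
    using herm[OF that] herm[OF that(1) c(1)] herm[OF c(1) that(2)] herm[OF c(1) c(1), symmetric]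
    by (simp add: Q_def)
  show "(\<Sum>z\<in>V. Q x z * Q z y) = Q x y" if "x \<in> V" "y \<in> V" for x y
  proof -
    have "(\<Sum>z\<in>V. Q x z * Q z y) = (\<Sum>z\<in>V. P x z * P z y)
        - (P c y / P c c) * (\<Sum>z\<in>V. P x z * P z c)
        - (P x c / P c c) * (\<Sum>z\<in>V. P c z * P z y)
        + (P x c / P c c) * (P c y / P c c) * (\<Sum>z\<in>V. P c z * P z c)"
      unfolding Q_def sum_distrib_left sum_subtractf[symmetric] sum.distrib[symmetric]
      by (intro sum.cong refl) (simp add: algebra_simps)
    also have "\<dots> = Q x y"
      using that c by (simp add: idem Q_def)
    finally show ?thesis .
  qed
  have "(\<Sum>x\<in>V. Q x x) = (\<Sum>x\<in>V. P x x) - (\<Sum>x\<in>V. P c x * P x c) / P c c"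
    by (simp add: Q_def sum_subtractf sum_divide_distrib mult.commute)
  then show "(\<Sum>x\<in>V. Q x x) = (\<Sum>x\<in>V. P x x) - 1"
    using c by (simp add: idem)
qed

text \<open>Two deflations bring the trace down to zero and hence leave nothing; the two subtracted
  rank-one terms add up to \<open>P\<close>.\<close>

lemma hermitian_projection_trace_two:
  fixes P :: "'a \<Rightarrow> 'a \<Rightarrow> complex"
  assumes fin: "finite V"
    and herm: "\<And>x y. x \<in> V \<Longrightarrow> y \<in> V \<Longrightarrow> P y x = cnj (P x y)"
    and idem: "\<And>x y. x \<in> V \<Longrightarrow> y \<in> V \<Longrightarrow> (\<Sum>z\<in>V. P x z * P z y) = P x y"
    and tr: "(\<Sum>x\<in>V. P x x) = 2"
  shows "\<exists>f g f' g'. \<forall>x\<in>V. \<forall>y\<in>V. P x y = f x * g y + f' x * g' y"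
proof -
  \<comment> \<open>A nonzero trace guarantees a nonzero diagonal entry to deflate at.\<close>
  obtain p where p: "p \<in> V" "P p p \<noteq> 0"
    using tr sum.neutral[of V "\<lambda>x. P x x"] by fastforce
  define Q where "Q x y = P x y - P x p * P p y / P p p" for x y
  note Q = hermitian_projection_deflate[OF herm idem p, folded Q_def]
  have "(\<Sum>x\<in>V. Q x x) = 1"
    using Q(3) tr by simp
  then obtain q where q: "q \<in> V" "Q q q \<noteq> 0"
    using sum.neutral[of V "\<lambda>x. Q x x"] by fastforce
  define R where "R x y = Q x y - Q x q * Q q y / Q q q" for x y
  note R = hermitian_projection_deflate[OF Q(1,2) q, folded R_def]
  have "(\<Sum>x\<in>V. R x x) = 0"
    using R(3) Q(3) tr by simp
  then have "R x y = 0" if "x \<in> V" "y \<in> V" for x y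
    using hermitian_projection_trace_zero[OF fin R(1,2)] that by blast
  then have *: "P x y = P x p * (P p y / P p p) + Q x q * (Q q y / Q q q)" if "x \<in> V" "y \<in> V" for x y
    using that by (simp add: R_def Q_def algebra_simps)
  show ?thesis
    by (rule exI[of _ "\<lambda>x. P x p"], rule exI[of _ "\<lambda>y. P p y / P p p"],
        rule exI[of _ "\<lambda>x. Q x q"], rule exI[of _ "\<lambda>y. Q q y / Q q q"]) (intro ballI *)
qed

text \<open>
  \<open>H\<^sup>2 / m\<close> is the orthogonal projection onto the range of \<open>H\<close> and has trace \<open>2\<close>, so \<open>H\<close> has
  rank \<open>2\<close>. Expanding a vanishing \<open>3 \<times> 3\<close> minor through the edge \<open>u w\<close> gives the claim.
\<close>
lemma hermitian_edge_expansion: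
  fixes H :: "'a \<Rightarrow> 'a \<Rightarrow> complex" and m :: nat
  assumes fin: "finite V" and m: "m > 0"
    and herm: "\<And>x y. x \<in> V \<Longrightarrow> y \<in> V \<Longrightarrow> H y x = cnj (H x y)"
    and diag: "\<And>x. x \<in> V \<Longrightarrow> H x x = 0"
    and cube: "\<And>x y. x \<in> V \<Longrightarrow> y \<in> V \<Longrightarrow> (\<Sum>z\<in>V. (\<Sum>w\<in>V. H x w * H w z) * H z y) = of_nat m * H x y"
    and tr: "(\<Sum>x\<in>V. \<Sum>y\<in>V. H x y * H y x) = 2 * of_nat m"
    and uw: "u \<in> V" "w \<in> V" "cmod (H u w) = 1"
    and xy: "x \<in> V" "y \<in> V"
  shows "H x y = H x u * H u w * H w y + H x w * H w u * H u y"
proof -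
  define S where "S x y = (\<Sum>z\<in>V. H x z * H z y)" for x y
  define P where "P x y = S x y / of_nat m" for x y
  have SH: "(\<Sum>z\<in>V. S x z * H z y) = of_nat m * H x y" if "x \<in> V" "y \<in> V" for x y
    using cube[OF that] by (simp add: S_def)
  have hermS: "S y x = cnj (S x y)" if "x \<in> V" "y \<in> V" for x y
    unfolding S_def cnj_sum using that by (intro sum.cong refl) (auto simp: herm[of x] herm[of _ y] mult.commute)
  have HS: "(\<Sum>z\<in>V. H x z * S z y) = of_nat m * H x y" if "x \<in> V" "y \<in> V" for x y
  proof -
    have "cnj (\<Sum>z\<in>V. H x z * S z y) = (\<Sum>z\<in>V. S y z * H z x)"
      unfolding cnj_sum using that by (intro sum.cong refl) (auto simp: herm[of x] hermS[of _ y] mult.commute)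
    also have "\<dots> = cnj (of_nat m * H x y)"
      by (simp add: SH[OF that(2,1)] herm[OF that])
    finally show ?thesis by (simp only: complex_cnj_cancel_iff)
  qed
  have hermP: "P y x = cnj (P x y)" if "x \<in> V" "y \<in> V" for x y
    using hermS[OF that] by (simp add: P_def)
  have idem: "(\<Sum>z\<in>V. P x z * P z y) = P x y" if "x \<in> V" "y \<in> V" for x y
  proof -
    \<comment> \<open>\<open>S\<close> is \<open>H\<^sup>2\<close>, and
      \<open>H\<^sup>4 = m H\<^sup>2\<close>; division by \<open>m\<close> makes it
      idempotent.\<close>
    have "(\<Sum>z\<in>V. S x z * S z y) = (\<Sum>z\<in>V. \<Sum>w\<in>V. S x z * H z w * H w y)"
      by (simp add: S_def[of _ y] sum_distrib_left mult.assoc)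
    also have "\<dots> = (\<Sum>w\<in>V. (\<Sum>z\<in>V. S x z * H z w) * H w y)"
      by (subst sum.swap) (simp add: sum_distrib_right)
    also have "\<dots> = (\<Sum>w\<in>V. of_nat m * (H x w * H w y))"
      using that by (intro sum.cong refl) (simp add: SH)
    also have "\<dots> = of_nat m * S x y"
      by (simp add: S_def sum_distrib_left)
    finally show ?thesis
      using m by (simp add: P_def flip: sum_divide_distrib)
  qed
  have "(\<Sum>x\<in>V. P x x) = (\<Sum>x\<in>V. \<Sum>y\<in>V. H x y * H y x) / of_nat m"
    by (simp add: P_def S_def sum_divide_distrib)
  then have trP: "(\<Sum>x\<in>V. P x x) = 2"
    using m tr by simp
  have "\<exists>f g f' g'. \<forall>x\<in>V. \<forall>y\<in>V. P x y = f x * g y + f' x * g' y"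
    by (rule hermitian_projection_trace_two[OF fin hermP idem trP])
  then obtain f g f' g' where fg0: "\<forall>x\<in>V. \<forall>y\<in>V. P x y = f x * g y + f' x * g' y"
    by (elim exE)
  then have fg: "P x y = f x * g y + f' x * g' y" if "x \<in> V" "y \<in> V" for x y
    using that by blast
  define k where "k y = (\<Sum>z\<in>V. g z * H z y)" for y
  define k' where "k' y = (\<Sum>z\<in>V. g' z * H z y)" for y
  \<comment> \<open>Since \<open>H = P H\<close>, the two-term factorization of \<open>P\<close>
    passes to \<open>H\<close>, with \<open>g\<close> and \<open>g'\<close> multiplied by
    \<open>H\<close> on the right.\<close>
  have rank2: "H x y = f x * k y + f' x * k' y" if "x \<in> V" "y \<in> V" for x y
  proof -
    have "H x y = (\<Sum>z\<in>V. S x z * H z y) / of_nat m"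
      using m that by (simp add: SH)
    also have "\<dots> = (\<Sum>z\<in>V. P x z * H z y)"
      by (simp add: P_def sum_divide_distrib)
    also have "\<dots> = (\<Sum>z\<in>V. f x * (g z * H z y) + f' x * (g' z * H z y))"
      using that by (intro sum.cong refl) (simp add: fg algebra_simps)
    also have "\<dots> = f x * k y + f' x * k' y"
      by (simp add: sum.distrib sum_distrib_left k_def k'_def)
    finally show ?thesis .
  qed
  \<comment> \<open>The determinant with rows \<open>x, u, w\<close> and columns
    \<open>y, u, w\<close>, expanded along its first row. With a zero diagonal and
    \<open>H u w * H w u = 1\<close> it becomes the claim.\<close>
  have minor: "H x y * (H u u * H w w - H u w * H w u) - H x u * (H u y * H w w - H u w * H w y)
      + H x w * (H u y * H w u - H u u * H w y) = 0"
    unfolding rank2[OF xy] rank2[OF uw(1,1)] rank2[OF uw(2,2)] rank2[OF uw(1,2)] rank2[OF uw(2,1)]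
      rank2[OF xy(1) uw(1)] rank2[OF xy(1) uw(2)] rank2[OF uw(1) xy(2)] rank2[OF uw(2) xy(2)]
    by (simp add: algebra_simps)
  have "H u w * H w u = 1"
    using uw herm[OF uw(1,2)] by (simp add: complex_norm_square[symmetric])
  then show ?thesis
    using minor uw by (simp add: diag algebra_simps)
qed

section \<open>Cyclic tripartite graphs and switching\<close>

text \<open>The parts are explicit and may be empty, because the parts recovered from a cospectral
  mate have sizes that are not known in advance.\<close>

definition cyclic_tripartite :: "'a set \<Rightarrow> 'a set \<Rightarrow> 'a set \<Rightarrow> 'a mixed_graph" where
  "cyclic_tripartite A B C =
     \<lparr>verts = A \<union> B \<union> C, edges = {}, arcs = A \<times> B \<union> B \<times> C \<union> C \<times> A\<rparr>"

text \<open>The last branches also cover points outside the three parts, which is how isolated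
  vertices of a mate are treated.\<close>

lemma hermitian_entry_cyclic_tripartite:
  assumes "A \<inter> B = {}" "B \<inter> C = {}" "C \<inter> A = {}"
  shows "hermitian_entry (cyclic_tripartite A B C) x y =
    (if x \<in> A then if y \<in> B then \<i> else if y \<in> C then - \<i> else 0
     else if x \<in> B then if y \<in> C then \<i> else if y \<in> A then - \<i> else 0
     else if x \<in> C then if y \<in> A then \<i> else if y \<in> B then - \<i> else 0
     else 0)"
  using assms by (auto simp: hermitian_entry_def cyclic_tripartite_def)

lemma mixed_graph_cyclic_tripartite:
  assumes "finite A" "finite B" "finite C" "A \<inter> B = {}" "B \<inter> C = {}" "C \<inter> A = {}"
  shows "mixed_graph (cyclic_tripartite A B C)"
  using assms by (auto simp: mixed_graph_def cyclic_tripartite_def)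

context
  fixes A B C :: "'a set" and h :: "'a \<Rightarrow> 'a \<Rightarrow> complex"
  assumes fin: "finite A" "finite B" "finite C"
    and disj: "A \<inter> B = {}" "B \<inter> C = {}" "C \<inter> A = {}"
  defines "h \<equiv> hermitian_entry (cyclic_tripartite A B C)"
begin

private lemma entry:
  "x \<in> A \<Longrightarrow> y \<in> A \<Longrightarrow> h x y = 0" "x \<in> A \<Longrightarrow> y \<in> B \<Longrightarrow> h x y = \<i>" "x \<in> A \<Longrightarrow> y \<in> C \<Longrightarrow> h x y = - \<i>"
  "x \<in> B \<Longrightarrow> y \<in> B \<Longrightarrow> h x y = 0" "x \<in> B \<Longrightarrow> y \<in> C \<Longrightarrow> h x y = \<i>" "x \<in> B \<Longrightarrow> y \<in> A \<Longrightarrow> h x y = - \<i>"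
  "x \<in> C \<Longrightarrow> y \<in> C \<Longrightarrow> h x y = 0" "x \<in> C \<Longrightarrow> y \<in> A \<Longrightarrow> h x y = \<i>" "x \<in> C \<Longrightarrow> y \<in> B \<Longrightarrow> h x y = - \<i>"
  using disj by (auto simp: h_def hermitian_entry_cyclic_tripartite[OF disj])

private lemma sum_parts:
  fixes f :: "'a \<Rightarrow> complex"
  shows "sum f (A \<union> B \<union> C) = sum f A + sum f B + sum f C"
proof -
  have "(A \<union> B) \<inter> C = {}"
    using disj by auto
  then show ?thesis
    using fin disj by (simp add: sum.union_disjoint)
qed

text \<open>A two-step walk that returns to its part contributes \<open>\<i> * (- \<i>) = 1\<close>.
  One between different parts passes through the third, either along two arcs or against two arcs,
  and contributes -1.\<close>

private lemma square:
  defines "S \<equiv> \<lambda>x y. \<Sum>z\<in>A \<union> B \<union> C. h x z * h z y"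
  shows "x \<in> A \<Longrightarrow> y \<in> A \<Longrightarrow> S x y = of_nat (card B) + of_nat (card C)"
    "x \<in> B \<Longrightarrow> y \<in> B \<Longrightarrow> S x y = of_nat (card C) + of_nat (card A)"
    "x \<in> C \<Longrightarrow> y \<in> C \<Longrightarrow> S x y = of_nat (card A) + of_nat (card B)"
    "x \<in> A \<Longrightarrow> y \<in> B \<Longrightarrow> S x y = - of_nat (card C)" "x \<in> B \<Longrightarrow> y \<in> A \<Longrightarrow> S x y = - of_nat (card C)"
    "x \<in> B \<Longrightarrow> y \<in> C \<Longrightarrow> S x y = - of_nat (card A)" "x \<in> C \<Longrightarrow> y \<in> B \<Longrightarrow> S x y = - of_nat (card A)"
    "x \<in> C \<Longrightarrow> y \<in> A \<Longrightarrow> S x y = - of_nat (card B)" "x \<in> A \<Longrightarrow> y \<in> C \<Longrightarrow> S x y = - of_nat (card B)"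
  unfolding S_def sum_parts by (simp_all add: entry)

text \<open>With part sizes \<open>a, b, c\<close>, for \<open>x\<close> in \<open>A\<close> and
  \<open>y\<close> in \<open>B\<close> the last step starts in \<open>A\<close> or in
  \<open>C\<close>, contributing \<open>\<i> * a * (b + c)\<close> and \<open>\<i> * b * c\<close>.
  For \<open>x\<close> and \<open>y\<close> in the same part the two contributions cancel. The
  remaining blocks are alike.\<close>

lemma cyclic_tripartite_cube:
  assumes "x \<in> A \<union> B \<union> C" "y \<in> A \<union> B \<union> C"
  shows "(\<Sum>z\<in>A \<union> B \<union> C. (\<Sum>w\<in>A \<union> B \<union> C. h x w * h w z) * h z y) =
    of_nat (card A * card B + card B * card C + card C * card A) * h x y"
  unfolding sum_parts[of "\<lambda>z. (\<Sum>w\<in>A \<union> B \<union> C. h x w * h w z) * h z y"] using assms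
  by (elim UnE; simp add: square entry; simp add: algebra_simps)

text \<open>Every edge is counted twice with weight \<open>\<i> * (- \<i>) = 1\<close>. Summing over
  a superset \<open>V\<close> of the parts allows for isolated vertices.\<close>

lemma cyclic_tripartite_edge_sum:
  assumes V: "finite V" "A \<union> B \<union> C \<subseteq> V"
  shows "(\<Sum>x\<in>V. \<Sum>y\<in>V. h x y * h y x) =
    2 * of_nat (card A * card B + card B * card C + card C * card A)"
proof -
  have outside: "h x y = 0" if "x \<notin> A \<union> B \<union> C \<or> y \<notin> A \<union> B \<union> C" for x y
    using that by (auto simp: h_def hermitian_entry_cyclic_tripartite[OF disj])
  have "(\<Sum>x\<in>V. \<Sum>y\<in>V. h x y * h y x) = (\<Sum>x\<in>A \<union> B \<union> C. \<Sum>y\<in>V. h x y * h y x)"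
    using V by (intro sum.mono_neutral_right) (auto simp: outside)
  also have "\<dots> = (\<Sum>x\<in>A \<union> B \<union> C. \<Sum>y\<in>A \<union> B \<union> C. h x y * h y x)"
    using V by (intro sum.cong refl sum.mono_neutral_right) (auto simp: outside)
  also have "\<dots> = 2 * of_nat (card A * card B + card B * card C + card C * card A)"
    unfolding sum_parts[of "\<lambda>x. \<Sum>y\<in>A \<union> B \<union> C. h x y * h y x"]
    by (simp add: square algebra_simps)
  finally show ?thesis .
qed

end

section \<open>Recovering the three parts up to switching\<close>

abbreviation unit4 :: "complex set" where
  "unit4 \<equiv> {1, -1, \<i>, - \<i>}"

text \<open>The supports of \<open>a\<close> and \<open>b\<close> sort the vertices:
  \<open>a\<close> alone, \<open>b\<close> alone, both, or neither, the last having zero rows. Where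
  both are nonzero, \<open>phase\<close> makes the two terms of \<open>h\<close> cancel, so there
  are no edges inside \<open>C\<close>.\<close>

lemma cyclic_tripartite_gauge:
  fixes h :: "'a \<Rightarrow> 'a \<Rightarrow> complex"
  assumes unit: "\<And>x. x \<in> V \<Longrightarrow> a x \<in> insert 0 unit4" "\<And>x. x \<in> V \<Longrightarrow> b x \<in> insert 0 unit4"
    and h: "\<And>x y. x \<in> V \<Longrightarrow> y \<in> V \<Longrightarrow> h x y = a x * cnj (b y) + b x * cnj (a y)"
    and phase: "\<And>x. x \<in> V \<Longrightarrow> a x \<noteq> 0 \<Longrightarrow> b x \<noteq> 0 \<Longrightarrow> b x = - \<i> * a x"
  shows "\<exists>A B C s. A \<union> B \<union> C \<subseteq> V \<and> A \<inter> B = {} \<and> B \<inter> C = {} \<and> C \<inter> A = {} \<and>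
    (\<forall>x\<in>V. s x \<in> unit4) \<and>
    (\<forall>x\<in>V. \<forall>y\<in>V. h x y = s x * cnj (s y) * hermitian_entry (cyclic_tripartite A B C) x y)"
proof -
  define A where "A = {x \<in> V. a x \<noteq> 0 \<and> b x = 0}"
  define B where "B = {x \<in> V. a x = 0 \<and> b x \<noteq> 0}"
  define C where "C = {x \<in> V. a x \<noteq> 0 \<and> b x \<noteq> 0}"
  \<comment> \<open>The weights absorb the entries of the cyclic graph: for \<open>x\<close> in
    \<open>A\<close> and \<open>y\<close> in \<open>B\<close>,
    \<open>a x * cnj (\<i> * b y) * \<i> = a x * cnj (b y)\<close>, and the sign on \<open>C\<close>
    fits the arcs from \<open>B\<close> to \<open>C\<close> and from \<open>C\<close> to
    \<open>A\<close>. On isolated vertices any unit would do.\<close>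
  define s where "s x = (if x \<in> A then a x else if x \<in> B then \<i> * b x else if x \<in> C then - a x else 1)" for x
  have disj: "A \<inter> B = {}" "B \<inter> C = {}" "C \<inter> A = {}"
    by (auto simp: A_def B_def C_def)
  have "s x \<in> unit4" if "x \<in> V" for x
    using unit[OF that] by (auto simp: s_def A_def B_def C_def)
  moreover have "h x y = s x * cnj (s y) * hermitian_entry (cyclic_tripartite A B C) x y"
    if "x \<in> V" "y \<in> V" for x y
    unfolding hermitian_entry_cyclic_tripartite[OF disj] h[OF that]
    using that phase[of x] phase[of y] by (auto simp: s_def A_def B_def C_def mult_ac)
  ultimately show ?thesis
    using disj by (intro exI[of _ A] exI[of _ B] exI[of _ C] exI[of _ s])
      (auto simp: A_def B_def C_def)
qed

text \<open>Take \<open>a\<close> as the column of \<open>u\<close> scaled by \<open>h u w\<close>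
  and \<open>b\<close> as the column of \<open>w\<close>. Where both are nonzero, the zero diagonal
  forces \<open>b x\<close> to be \<open>\<i> * a x\<close> or \<open>- \<i> * a x\<close>; it
  remains to see that the sign is the same at all such vertices.\<close>

lemma edge_expansion_cyclic_tripartite:
  fixes h :: "'a \<Rightarrow> 'a \<Rightarrow> complex"
  assumes unit: "\<And>x y. x \<in> V \<Longrightarrow> y \<in> V \<Longrightarrow> h x y \<in> insert 0 unit4"
    and herm: "\<And>x y. x \<in> V \<Longrightarrow> y \<in> V \<Longrightarrow> h y x = cnj (h x y)"
    and diag: "\<And>x. x \<in> V \<Longrightarrow> h x x = 0"
    and uw: "u \<in> V" "w \<in> V"
    and exp: "\<And>x y. x \<in> V \<Longrightarrow> y \<in> V \<Longrightarrow> h x y = h x u * h u w * h w y + h x w * h w u * h u y"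
  shows "\<exists>A B C s. A \<union> B \<union> C \<subseteq> V \<and> A \<inter> B = {} \<and> B \<inter> C = {} \<and> C \<inter> A = {} \<and>
    (\<forall>x\<in>V. s x \<in> unit4) \<and>
    (\<forall>x\<in>V. \<forall>y\<in>V. h x y = s x * cnj (s y) * hermitian_entry (cyclic_tripartite A B C) x y)"
proof -
  define a where "a x = h x u * h u w" for x
  define b where "b x = h x w" for x
  have h: "h x y = a x * cnj (b y) + b x * cnj (a y)" if "x \<in> V" "y \<in> V" for x y
    using exp[OF that] herm[OF that(2) uw(1)] herm[OF that(2) uw(2)] herm[OF uw]
    by (simp add: a_def b_def)
  have aU: "a x \<in> insert 0 unit4" and bU: "b x \<in> insert 0 unit4" if "x \<in> V" for x
    using unit[OF that uw(1)] unit[OF that uw(2)] unit[OF uw] by (auto simp: a_def b_def)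
  have phase: "b x = \<i> * a x \<or> b x = - \<i> * a x" if "x \<in> V" "a x \<noteq> 0" "b x \<noteq> 0" for x
    using aU[OF that(1)] bU[OF that(1)] h[OF that(1,1)] diag[OF that(1)] that
    by (auto simp: complex_eq_iff)
  \<comment> \<open>With opposite signs at \<open>x\<close> and \<open>y\<close> the two terms of
    \<open>h x y\<close> add up to modulus 2, which no entry has.\<close>
  have coherent: False if x: "x \<in> V" "a x \<noteq> 0" "b x = \<i> * a x"
    and y: "y \<in> V" "a y \<noteq> 0" "b y = - \<i> * a y" for x y
  proof -
    have "h x y = 2 * \<i> * a x * cnj (a y)"
      using h[OF x(1) y(1)] x y by (simp add: algebra_simps)
    then have "cmod (h x y) = 2"
      using aU[OF x(1)] aU[OF y(1)] x y by (auto simp: norm_mult)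
    then show False
      using unit[OF x(1) y(1)] by auto
  qed
  show ?thesis
  proof (cases "\<exists>x\<in>V. a x \<noteq> 0 \<and> b x = \<i> * a x")
    case False
    then show ?thesis
      using phase by (intro cyclic_tripartite_gauge[of V a b h] aU bU h) blast+
  next
    case True
    then have ba: "b x = \<i> * a x" if "x \<in> V" "a x \<noteq> 0" "b x \<noteq> 0" for x
      using phase[OF that] coherent that by blast
    \<comment> \<open>The expansion is symmetric in \<open>a\<close> and \<open>b\<close>, and
      exchanging them turns the ratio \<open>\<i>\<close> into \<open>- \<i>\<close>.\<close>
    have "a x = - \<i> * b x" if "x \<in> V" "b x \<noteq> 0" "a x \<noteq> 0" for x
      unfolding ba[OF that(1,3,2)] by simp
    then show ?thesis
      using h by (intro cyclic_tripartite_gauge[of V b a h] aU bU) (auto simp: add.commute)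
  qed
qed

section \<open>Arithmetic of the part sizes\<close>

text \<open>
  \<open>(a + b + c)\<^sup>2 - 3 (a b + b c + c a)\<close> is half the sum of the squared differences of the part
  sizes; for the sizes \<open>k, k, l\<close> it is \<open>(k - l)\<^sup>2 \<le> 1\<close>.
\<close>
lemma balanced_parts:
  fixes a b c k l :: nat
  assumes k: "k \<ge> 1" "l \<ge> 1" "\<bar>int k - int l\<bar> \<le> 1"
    and le: "a + b + c \<le> 2 * k + l"
    and eq: "a * b + b * c + c * a = k * k + 2 * k * l"
  shows "(a, b, c) \<in> {(k, k, l), (k, l, k), (l, k, k)}"
proof -
  define A B C K L where "A = int a" and "B = int b" and "C = int c" and "K = int k" and "L = int l"
  note defs = A_def B_def C_def K_def L_def
  have le': "A + B + C \<le> 2 * K + L" and nn: "A \<ge> 0" "B \<ge> 0" "C \<ge> 0" "K \<ge> 1" "L \<ge> 1"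
    using le k by (auto simp: defs)
  have "int (a * b + b * c + c * a) = int (k * k + 2 * k * l)"
    using eq by simp
  then have eq': "A * B + B * C + C * A = K * K + 2 * K * L"
    by (simp add: defs)
  have e: "K - L \<in> {-1, 0, 1}"
    using k by (auto simp: defs)
  then have e2: "(K - L) * (K - L) \<le> 1" by auto
  define s2 n2 m2 where "s2 = (A + B + C) * (A + B + C)" and "n2 = (2 * K + L) * (2 * K + L)"
    and "m2 = A * B + B * C + C * A"
  have id1: "2 * ((A + B + C) * (A + B + C)) - 6 * (A * B + B * C + C * A) =
      (A - B) * (A - B) + (B - C) * (B - C) + (C - A) * (C - A)"
    by (simp add: algebra_simps)
  have id2: "2 * ((2 * K + L) * (2 * K + L)) - 6 * (K * K + 2 * K * L) = 2 * ((K - L) * (K - L))"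
    by (simp add: algebra_simps)
  \<comment> \<open>Put \<open>n = 2 * K + L\<close>. A smaller total would give
    \<open>n\<^sup>2 - 1 \<le> 3 m \<le> (n - 1)\<^sup>2\<close>, hence
    \<open>n \<le> 1\<close>.\<close>
  have sum: "A + B + C = 2 * K + L"
  proof (rule ccontr)
    assume "A + B + C \<noteq> 2 * K + L"
    then have "A + B + C \<le> 2 * K + L - 1" using le' by simp
    then have "(A + B + C) * (A + B + C) \<le> (2 * K + L - 1) * (2 * K + L - 1)"
      using nn by (intro mult_mono) auto
    also have "\<dots> = (2 * K + L) * (2 * K + L) - 2 * (2 * K + L) + 1"
      by (simp add: algebra_simps)
    finally have "s2 \<le> n2 - 2 * (2 * K + L) + 1"
      by (simp add: s2_def n2_def)
    moreover have "0 \<le> 2 * s2 - 6 * m2"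
      unfolding s2_def m2_def id1 by simp
    moreover have "2 * n2 - 6 * m2 \<le> 2"
      unfolding n2_def m2_def eq' id2 using e2 by simp
    ultimately have "2 * K + L \<le> 1" by presburger
    then show False using nn by simp
  qed
  \<comment> \<open>The differences of the sizes are \<open>p\<close>, \<open>q\<close> and
    \<open>- (p + q)\<close>. Their squares sum to at most 2, which leaves finitely many pairs to
    check.\<close>
  define p q where "p = A - B" and "q = B - C"
  have pq: "p * p + q * q + (p + q) * (p + q) = 2 * ((K - L) * (K - L))"
  proof -
    have "(C - A) * (C - A) = (p + q) * (p + q)" by (simp add: p_def q_def algebra_simps)
    then show ?thesis
      using id1 id2 eq' sum by (simp add: p_def q_def)
  qed
  have small: "z \<in> {-1, 0, 1}" if "z * z \<le> 2" for z :: int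
  proof -
    have "\<bar>z\<bar> < 2"
    proof (rule ccontr)
      assume "\<not> \<bar>z\<bar> < 2"
      then have "2 * 2 \<le> \<bar>z\<bar> * \<bar>z\<bar>" by (intro mult_mono) auto
      then show False using that by simp
    qed
    then show ?thesis by auto
  qed
  have "p \<in> {-1, 0, 1}" "q \<in> {-1, 0, 1}"
    using pq e2 zero_le_square[of p] zero_le_square[of q] zero_le_square[of "p + q"]
    by (intro small; linarith)+
  then have "p = 0 \<and> q = 0 \<and> K = L \<or> (K = L + 1 \<or> L = K + 1) \<and>
      (p, q) \<in> {(1, 0), (-1, 0), (0, 1), (0, -1), (1, -1), (-1, 1)}"
    using pq e by auto
  moreover have "A = B + p" "B = C + q"
    by (simp_all add: p_def q_def)
  ultimately have "A = K \<and> B = K \<and> C = L \<or> A = K \<and> B = L \<and> C = K \<or> A = L \<and> B = K \<and> C = K"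
    using sum unfolding insert_iff prod.inject empty_iff by (smt (verit))
  then show ?thesis by (auto simp: defs)
qed

section \<open>Hermitian adjacency matrices\<close>

lemma vertex_list:
  assumes "finite V"
  shows "distinct (vertex_list V)" "set (vertex_list V) = V" "length (vertex_list V) = card V"
proof -
  have "\<exists>xs. distinct xs \<and> set xs = V"
    using finite_distinct_list[OF assms] by blast
  then have "distinct (vertex_list V) \<and> set (vertex_list V) = V"
    unfolding vertex_list_def by (rule someI_ex)
  then show "distinct (vertex_list V)" "set (vertex_list V) = V" "length (vertex_list V) = card V"
    using distinct_card[of "vertex_list V"] by auto
qed

lemma sum_vertex_list:
  assumes "finite V"
  shows "(\<Sum>i<card V. F (vertex_list V ! i)) = sum F V"
  using sum.reindex_bij_betw[OF bij_betw_nth[of "vertex_list V" "{..<card V}" V]] vertex_list[OF assms]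
  by simp

lemma vertex_list_nth_mem:
  assumes "finite V" "i < card V"
  shows "vertex_list V ! i \<in> V"
  using assms vertex_list[OF assms(1)] nth_mem by metis

lemma vertex_list_index:
  assumes "finite V" "x \<in> V"
  obtains i where "i < card V" "vertex_list V ! i = x"
  using assms vertex_list[OF assms(1)] by (metis in_set_conv_nth)

lemma hermitian_entry_values: "hermitian_entry D x y \<in> insert 0 unit4"
  by (simp add: hermitian_entry_def)

lemma hermitian_entry_cnj:
  assumes "mixed_graph D"
  shows "hermitian_entry D y x = cnj (hermitian_entry D x y)"
  using assms by (auto simp: hermitian_entry_def mixed_graph_def insert_commute)

lemma hermitian_entry_diag:
  assumes "mixed_graph D"
  shows "hermitian_entry D x x = 0"
  using assms by (auto simp: hermitian_entry_def mixed_graph_def)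

context
  fixes D :: "'a mixed_graph" and h xs n M
  assumes D: "mixed_graph D"
  defines "h \<equiv> hermitian_entry D" and "xs \<equiv> vertex_list (verts D)" and "n \<equiv> card (verts D)"
    and "M \<equiv> hermitian_adj D"
begin

lemma hermitian_adj_carrier: "M \<in> carrier_mat n n"
  by (simp add: M_def n_def hermitian_adj_def)

lemma hermitian_adj_entry: "i < n \<Longrightarrow> j < n \<Longrightarrow> M $$ (i, j) = h (xs ! i) (xs ! j)"
  by (simp add: M_def n_def xs_def h_def hermitian_adj_def)

private lemma fin: "finite (verts D)"
  using D by (simp add: mixed_graph_def)

lemma hermitian_adj_trace_square:
  "mat_trace (M ^\<^sub>m 2) = (\<Sum>x\<in>verts D. \<Sum>y\<in>verts D. h x y * h y x)"
proof -
  have "M ^\<^sub>m 2 = M * M"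
    using hermitian_adj_carrier by (simp add: numeral_2_eq_2)
  then have "mat_trace (M ^\<^sub>m 2) = (\<Sum>i<n. \<Sum>j<n. h (xs ! i) (xs ! j) * h (xs ! j) (xs ! i))"
    by (simp add: mat_trace_mult[OF hermitian_adj_carrier hermitian_adj_carrier] hermitian_adj_entry)
  then show ?thesis
    by (simp add: xs_def n_def sum_vertex_list[OF fin] sum_vertex_list[OF fin, where F = "\<lambda>x. \<Sum>y\<in>verts D. h x y * h y x"]
        sum_vertex_list[OF fin, where F = "\<lambda>y. h _ y * h y _"])
qed

lemma hermitian_adj_cube_entry:
  assumes "i < n" "j < n"
  shows "(M ^\<^sub>m 3) $$ (i, j) =
    (\<Sum>z\<in>verts D. (\<Sum>w\<in>verts D. h (xs ! i) w * h w z) * h z (xs ! j))"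
proof -
  note M = hermitian_adj_carrier
  have M2: "M * M \<in> carrier_mat n n" using M by simp
  have "M ^\<^sub>m 3 = (M * M) * M"
    using M by (simp add: numeral_3_eq_3)
  then have "(M ^\<^sub>m 3) $$ (i, j) =
      (\<Sum>k<n. (\<Sum>l<n. h (xs ! i) (xs ! l) * h (xs ! l) (xs ! k)) * h (xs ! k) (xs ! j))"
    using assms by (simp add: mult_mat_entry[OF M2 M] mult_mat_entry[OF M M] hermitian_adj_entry)
  then show ?thesis
    by (simp add: xs_def n_def sum_vertex_list[OF fin, where F = "\<lambda>w. h _ w * h w _"]
      sum_vertex_list[OF fin, where F = "\<lambda>z. (\<Sum>w\<in>verts D. h _ w * h w z) * h z _"])
qed

end

section \<open>Switching along a bijection of vertex sets\<close>

text \<open>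
  Four-way switching by \<open>S\<close> turns \<open>H(D)\<close> into \<open>S\<^sup>-\<^sup>1 H(D) S\<close>; on the \<open>D'\<close> side the diagonal of
  \<open>S\<^sup>-\<^sup>1\<close> is \<open>s\<close>.
\<close>
lemma switched_copy:
  fixes D :: "'a mixed_graph" and D' :: "'b mixed_graph"
  assumes D: "mixed_graph D" and D': "mixed_graph D'"
    and f: "bij_betw f (verts D') (verts D)"
    and s: "\<And>x. x \<in> verts D' \<Longrightarrow> s x \<in> unit4"
    and h: "\<And>x y. x \<in> verts D' \<Longrightarrow> y \<in> verts D' \<Longrightarrow>
      hermitian_entry D' x y = s x * cnj (s y) * hermitian_entry D (f x) (f y)"
  shows "\<exists>D''. four_way_switching D D'' \<and> isomorphic D' D''"
proof -
  \<comment> \<open>\<open>D''\<close> is \<open>D'\<close> transported along \<open>f\<close>, so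
    the isomorphism is built in and the switching relation to \<open>D\<close> is what has to be
    verified.\<close>
  define D'' where "D'' = \<lparr>verts = verts D, edges = (`) f ` edges D', arcs = map_prod f f ` arcs D'\<rparr>"
  have V'': "verts D'' = verts D" by (simp add: D''_def)
  have inj: "inj_on f (verts D')" and im: "f ` verts D' = verts D"
    using f by (auto simp: bij_betw_def)
  have fin: "finite (verts D)" using D by (simp add: mixed_graph_def)
  have e_sub: "edges D' \<subseteq> Pow (verts D')" and a_sub: "arcs D' \<subseteq> verts D' \<times> verts D'"
    and e_card: "\<And>e. e \<in> edges D' \<Longrightarrow> card e = 2"
    using D' by (auto simp: mixed_graph_def)
  have edge: "{f x, f y} \<in> edges D'' \<longleftrightarrow> {x, y} \<in> edges D'" if "x \<in> verts D'" "y \<in> verts D'" for x y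
    using inj_on_image_mem_iff[OF inj_on_image_Pow[OF inj], of "{x, y}" "edges D'"] that e_sub
    by (simp add: D''_def)
  have arc: "(f x, f y) \<in> arcs D'' \<longleftrightarrow> (x, y) \<in> arcs D'" if "x \<in> verts D'" "y \<in> verts D'" for x y
    using inj_on_image_mem_iff[OF map_prod_inj_on[OF inj inj], of "(x, y)" "arcs D'"] that a_sub
    by (simp add: D''_def)
  have mixed: "mixed_graph D''"
    unfolding mixed_graph_def
  proof (intro conjI ballI)
    show "finite (verts D'')" using fin V'' by simp
  next
    fix e assume "e \<in> edges D''"
    then obtain e' where e': "e' \<in> edges D'" "e = f ` e'" by (auto simp: D''_def)
    show "e \<subseteq> verts D''" using e' e_sub im V'' by auto
    show "card e = 2" using e' e_card e_sub inj by (metis PowD card_image inj_on_subset subsetD)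
  next
    have *: "\<exists>x y. p = (f x, f y) \<and> (x, y) \<in> arcs D' \<and> x \<in> verts D' \<and> y \<in> verts D'" if "p \<in> arcs D''" for p
      using that a_sub by (auto simp: D''_def)
    fix p assume p: "p \<in> arcs D''"
    then obtain x y where xy: "p = (f x, f y)" "(x, y) \<in> arcs D'" "x \<in> verts D'" "y \<in> verts D'"
      using * by blast
    then have "x \<noteq> y" "(y, x) \<notin> arcs D'" "{x, y} \<notin> edges D'"
      using D' by (auto simp: mixed_graph_def)
    then have "f x \<noteq> f y" "(f y, f x) \<notin> arcs D''" "{f x, f y} \<notin> edges D''"
      using xy edge arc inj by (auto simp: inj_on_eq_iff)
    then show "case p of (u, v) \<Rightarrow> u \<in> verts D'' \<and> v \<in> verts D'' \<and> u \<noteq> v"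
      "case p of (u, v) \<Rightarrow> (v, u) \<notin> arcs D''" "case p of (u, v) \<Rightarrow> {u, v} \<notin> edges D''"
      using xy im V'' by auto
  qed
  have iso: "isomorphic D' D''"
    unfolding isomorphic_def V'' using f edge arc by blast
  define g where "g = the_inv_into (verts D') f"
  have g: "g v \<in> verts D'" "f (g v) = v" if "v \<in> verts D" for v
    using that im the_inv_into_into[OF inj _ subset_refl] f_the_inv_into_f[OF inj] by (auto simp: g_def)
  have h'': "hermitian_entry D'' u v = s (g u) * cnj (s (g v)) * hermitian_entry D u v"
    if "u \<in> verts D" "v \<in> verts D" for u v
  proof -
    have "hermitian_entry D'' (f x) (f y) = hermitian_entry D' x y" if "x \<in> verts D'" "y \<in> verts D'" for x y
      using that by (simp add: hermitian_entry_def edge arc)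
    from this[of "g u" "g v"] h[of "g u" "g v"] show ?thesis
      using g that by simp
  qed
  define n where "n = card (verts D)"
  define xs where "xs = vertex_list (verts D)"
  define t where "t i = s (g (xs ! i))" for i
  have xs: "xs ! i \<in> verts D" if "i < n" for i
    using that fin by (simp add: xs_def n_def vertex_list_nth_mem)
  have t: "t i \<in> unit4" if "i < n" for i
    using s g xs that by (simp add: t_def)
  have tt: "t i * cnj (t i) = 1" if "i < n" for i
    using t[OF that] by auto
  have ct: "cnj (t i) \<in> unit4" if "i < n" for i
    using t[OF that] by auto
  \<comment> \<open>The numbers \<open>t i\<close> have modulus one, so conjugation inverts them and
    \<open>S\<close> is the inverse of \<open>T\<close>.\<close>
  define S where "S = mat n n (\<lambda>(i, j). if i = j then cnj (t i) else 0)"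
  define T where "T = mat n n (\<lambda>(i, j). if i = j then t i else 0)"
  have ST: "S \<in> carrier_mat n n" "T \<in> carrier_mat n n"
    by (simp_all add: S_def T_def)
  have S_entry: "S $$ (i, j) = (if i = j then cnj (t i) else 0)" if "i < n" "j < n" for i j
    using that by (simp add: S_def)
  have H: "hermitian_adj D \<in> carrier_mat n n" "hermitian_adj D'' \<in> carrier_mat n n"
    using hermitian_adj_carrier[OF D] hermitian_adj_carrier[OF mixed] by (simp_all add: n_def V'')
  have Tmult: "(T * X) $$ (i, j) = t i * X $$ (i, j)" if "X \<in> carrier_mat n n" "i < n" "j < n" for X i j
    unfolding mult_mat_entry[OF ST(2) that] using that by (simp add: T_def if_distrib[of "\<lambda>z. z * _"] cong: if_cong)
  have Smult: "(X * S) $$ (i, j) = X $$ (i, j) * cnj (t j)" if "X \<in> carrier_mat n n" "i < n" "j < n" for X i j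
    unfolding mult_mat_entry[OF that(1) ST(1) that(2,3)] using that by (simp add: S_def if_distrib[of "\<lambda>z. _ * z"] cong: if_cong)
  have "S \<in> switching_matrices n"
    using ST ct by (auto simp: switching_matrices_def diagonal_mat_def S_def)
  moreover have "similar_mat_wit (hermitian_adj D'') (hermitian_adj D) T S"
  proof (rule similar_mat_witI)
    show TS: "T * S = 1\<^sub>m n"
      using ST S_entry by (intro eq_matI) (auto simp: Tmult[OF ST(1)] tt simp del: index_mult_mat(1))
    show "S * T = 1\<^sub>m n"
      using mat_mult_left_right_inverse[OF ST(2,1) TS] .
    show "hermitian_adj D'' = T * hermitian_adj D * S"
    proof (rule eq_matI)
      fix i j assume "i < dim_row (T * hermitian_adj D * S)" "j < dim_col (T * hermitian_adj D * S)"
      then have ij: "i < n" "j < n" using ST by auto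
      have "(T * hermitian_adj D * S) $$ (i, j) = t i * cnj (t j) * hermitian_adj D $$ (i, j)"
        using Smult[OF mult_carrier_mat[OF ST(2) H(1)] ij] Tmult[OF H(1) ij] by simp
      also have "\<dots> = hermitian_adj D'' $$ (i, j)"
        using ij hermitian_adj_entry[OF D, of i j] hermitian_adj_entry[OF mixed, of i j] xs
        by (simp add: V'' h'' t_def flip: n_def xs_def)
      finally show "hermitian_adj D'' $$ (i, j) = (T * hermitian_adj D * S) $$ (i, j)" by simp
    qed (use ST H in auto)
  qed (use ST H in auto)
  ultimately have "four_way_switching D D''"
    unfolding four_way_switching_def using mixed V'' by (auto simp flip: n_def)
  with iso show ?thesis by blast
qed

section \<open>Cospectral mates of balanced cyclic tripartite graphs\<close>

lemma bij_betw_parts: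
  assumes "finite A" "finite B" "finite C" "finite A'" "finite B'" "finite C'"
    and disj: "A \<inter> B = {}" "B \<inter> C = {}" "C \<inter> A = {}"
    and disj': "A' \<inter> B' = {}" "B' \<inter> C' = {}" "C' \<inter> A' = {}"
    and "card A' = card A" "card B' = card B" "card C' = card C"
  shows "\<exists>f. bij_betw f (A' \<union> B' \<union> C') (A \<union> B \<union> C) \<and> f ` A' = A \<and> f ` B' = B \<and> f ` C' = C"
proof -
  obtain fa fb fc where fs: "bij_betw fa A' A" "bij_betw fb B' B" "bij_betw fc C' C"
    using assms finite_same_card_bij by metis
  define f where "f x = (if x \<in> A' then fa x else if x \<in> B' then fb x else fc x)" for x
  have "bij_betw f A' A" "bij_betw f B' B" "bij_betw f C' C"
    using fs disj' by (subst bij_betw_cong[of _ f]; force simp: f_def)+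
  then show ?thesis
    using disj by (intro exI[of _ f]) (auto intro!: bij_betw_combine simp: bij_betw_imp_surj_on)
qed

lemma card_disjoint_parts:
  assumes "finite A" "finite B" "finite C" "A \<inter> B = {}" "B \<inter> C = {}" "C \<inter> A = {}"
  shows "card (A \<union> B \<union> C) = card A + card B + card C"
proof -
  have "(A \<union> B) \<inter> C = {}"
    using assms by auto
  then show ?thesis
    using assms by (simp add: card_Un_disjoint)
qed

text \<open>Up to rotation all three families have sizes \<open>k, k, l\<close> with
  \<open>k\<close> and \<open>l\<close> differing by at most one, so a single statement serves them
  all.\<close>

lemma cyclic_tripartite_DHS:
  fixes A B C :: "'a set"
  assumes fin: "finite A" "finite B" "finite C"
    and disj: "A \<inter> B = {}" "B \<inter> C = {}" "C \<inter> A = {}"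
    and card: "card A = k" "card B = k" "card C = l"
    and kl: "k \<ge> 1" "l \<ge> 1" "\<bar>int k - int l\<bar> \<le> 1"
  shows "DHS TYPE('b) (cyclic_tripartite A B C)"
  unfolding DHS_def
proof (intro conjI allI impI)
  let ?D = "cyclic_tripartite A B C"
  show D: "mixed_graph ?D"
    by (rule mixed_graph_cyclic_tripartite[OF fin disj])
  fix D' :: "'b mixed_graph"
  assume "mixed_graph D' \<and> H_cospectral D' ?D"
  then have D': "mixed_graph D'" and cosp: "H_cospectral D' ?D" by auto
  define V h m N where "V = verts D'" and "h = hermitian_entry D'" and "m = k * k + 2 * k * l"
    and "N = card (verts ?D)"
  have VD: "verts ?D = A \<union> B \<union> C" by (simp add: cyclic_tripartite_def)
  have N: "N = 2 * k + l"
    using card_disjoint_parts[OF fin disj] card by (simp add: N_def VD)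
  have m: "card A * card B + card B * card C + card C * card A = m"
    by (simp add: card m_def)
  let ?M = "hermitian_adj ?D" and ?M' = "hermitian_adj D'"
  note M = hermitian_adj_carrier[OF D, folded N_def] and M' = hermitian_adj_carrier[OF D']
  have NV: "card (verts D') = N" and tr: "mat_trace (?M' ^\<^sub>m e) = mat_trace (?M ^\<^sub>m e)" for e
    using same_orders_same_trace_pow[OF M' M] cosp by (auto simp: H_cospectral_def)
  have M3: "(?M ^\<^sub>m 3) $$ (i, j) = of_nat m * ?M $$ (i, j)" if "i < N" "j < N" for i j
  proof -
    have "vertex_list (verts ?D) ! i \<in> A \<union> B \<union> C" "vertex_list (verts ?D) ! j \<in> A \<union> B \<union> C"
      using that fin vertex_list_nth_mem[of "verts ?D"] by (auto simp: N_def VD)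
    note cube = cyclic_tripartite_cube[OF fin disj this, folded VD, unfolded m]
    show ?thesis
      unfolding hermitian_adj_cube_entry[OF D that[unfolded N_def]]
        hermitian_adj_entry[OF D that[unfolded N_def]] by (rule cube)
  qed
  have tr2: "mat_trace (?M ^\<^sub>m 2) = 2 * of_nat m"
    unfolding hermitian_adj_trace_square[OF D] VD
    using cyclic_tripartite_edge_sum[OF fin disj _ subset_refl] fin by (simp add: m)
  \<comment> \<open>Since \<open>H\<^sup>4 = m H\<^sup>2\<close> and
    \<open>H\<^sup>6 = m\<^sup>2 H\<^sup>2\<close>, the two higher traces are multiples of this
    sum.\<close>
  have sq: "(\<Sum>i<N. \<Sum>j<N. ?M $$ (i, j) * ?M $$ (j, i)) = 2 * of_nat m"
    using tr2 mat_trace_mult[OF M M] M by (simp add: numeral_2_eq_2)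
  have M3c: "?M ^\<^sub>m 3 \<in> carrier_mat N N" using M by simp
  have tr4: "mat_trace (?M ^\<^sub>m 4) = 2 * of_nat m ^ 2"
  proof -
    have "?M ^\<^sub>m 4 = ?M ^\<^sub>m 3 * ?M"
      using pow_mat_add[OF M, of 3 1] M by simp
    then have "mat_trace (?M ^\<^sub>m 4) = (\<Sum>i<N. \<Sum>j<N. of_nat m * (?M $$ (i, j) * ?M $$ (j, i)))"
      by (simp add: mat_trace_mult[OF M3c M] M3 mult.assoc)
    also have "\<dots> = of_nat m * (2 * of_nat m)"
      by (simp add: sq flip: sum_distrib_left)
    finally show ?thesis by (simp add: power2_eq_square)
  qed
  have tr6: "mat_trace (?M ^\<^sub>m 6) = 2 * of_nat m ^ 3"
  proof -
    have "?M ^\<^sub>m 6 = ?M ^\<^sub>m 3 * ?M ^\<^sub>m 3"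
      using pow_mat_add[OF M, of 3 3] by simp
    then have "mat_trace (?M ^\<^sub>m 6) = (\<Sum>i<N. \<Sum>j<N. of_nat m ^ 2 * (?M $$ (i, j) * ?M $$ (j, i)))"
      by (simp add: mat_trace_mult[OF M3c M3c] M3 power2_eq_square mult_ac)
    also have "\<dots> = of_nat m ^ 2 * (2 * of_nat m)"
      by (simp add: sq flip: sum_distrib_left)
    finally show ?thesis by (simp add: power2_eq_square power3_eq_cube)
  qed
  have finV: "finite V" using D' by (simp add: V_def mixed_graph_def)
  have cardV: "card V = N" using NV by (simp add: V_def)
  have cube': "(\<Sum>z\<in>V. (\<Sum>w\<in>V. h x w * h w z) * h z y) = of_nat m * h x y" if xy: "x \<in> V" "y \<in> V" for x y
  proof -
    obtain i j where ij: "i < N" "vertex_list V ! i = x" "j < N" "vertex_list V ! j = y"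
      using vertex_list_index[OF finV] xy cardV by metis
    have "?M' $$ (b, a) = cnj (?M' $$ (a, b))" if "a < N" "b < N" for a b
      using that hermitian_adj_entry[OF D', unfolded NV]
      by (simp add: hermitian_entry_cnj[OF D', of "vertex_list (verts D') ! b" "vertex_list (verts D') ! a"])
    then have "(?M' ^\<^sub>m 3) $$ (i, j) = of_nat m * ?M' $$ (i, j)"
      by (rule hermitian_cube_from_traces[OF M'[unfolded NV] _ _ _ _ ij(1,3)])
        (simp_all add: tr tr2 tr4 tr6)
    then show ?thesis
      using hermitian_adj_cube_entry[OF D', of i j, unfolded NV] hermitian_adj_entry[OF D', of i j, unfolded NV] ij
      by (simp add: V_def h_def)
  qed
  have tr2': "(\<Sum>x\<in>V. \<Sum>y\<in>V. h x y * h y x) = 2 * of_nat m"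
    using hermitian_adj_trace_square[OF D'] tr tr2 by (simp add: V_def h_def)
  have m_pos: "m > 0" using kl by (simp add: m_def)
  have unit: "h x y \<in> insert 0 unit4" for x y
    unfolding h_def by (rule hermitian_entry_values)
  have herm: "h y x = cnj (h x y)" for x y
    unfolding h_def by (rule hermitian_entry_cnj[OF D'])
  have diag: "h x x = 0" for x
    unfolding h_def by (rule hermitian_entry_diag[OF D'])
  obtain u w where uw: "u \<in> V" "w \<in> V" "h u w \<noteq> 0"
  proof (rule ccontr)
    assume "\<not> thesis"
    then have "h x y = 0" if "x \<in> V" "y \<in> V" for x y
      using that \<open>\<And>w u. u \<in> V \<Longrightarrow> w \<in> V \<Longrightarrow> h u w \<noteq> 0 \<Longrightarrow> thesis\<close> by blast
    then have "(\<Sum>x\<in>V. \<Sum>y\<in>V. h x y * h y x) = 0" by simp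
    then show False using tr2' m_pos by simp
  qed
  have "cmod (h u w) = 1"
    using unit[of u w] uw(3) by auto
  then have exp: "h x y = h x u * h u w * h w y + h x w * h w u * h u y" if "x \<in> V" "y \<in> V" for x y
    by (intro hermitian_edge_expansion[OF finV m_pos herm diag cube' tr2' uw(1,2) _ that])
  have "\<exists>A' B' C' s. A' \<union> B' \<union> C' \<subseteq> V \<and> A' \<inter> B' = {} \<and> B' \<inter> C' = {} \<and> C' \<inter> A' = {} \<and>
      (\<forall>x\<in>V. s x \<in> unit4) \<and>
      (\<forall>x\<in>V. \<forall>y\<in>V. h x y = s x * cnj (s y) * hermitian_entry (cyclic_tripartite A' B' C') x y)"
    by (rule edge_expansion_cyclic_tripartite[OF unit herm diag uw(1,2) exp])
  then obtain A' B' C' s where sub: "A' \<union> B' \<union> C' \<subseteq> V"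
    and disj': "A' \<inter> B' = {}" "B' \<inter> C' = {}" "C' \<inter> A' = {}"
    and s0: "\<forall>x\<in>V. s x \<in> unit4"
    and hs0: "\<forall>x\<in>V. \<forall>y\<in>V. h x y = s x * cnj (s y) * hermitian_entry (cyclic_tripartite A' B' C') x y"
    by (elim exE conjE)
  have s: "s x \<in> unit4" if "x \<in> V" for x
    using s0 that by blast
  have hs: "h x y = s x * cnj (s y) * hermitian_entry (cyclic_tripartite A' B' C') x y"
    if "x \<in> V" "y \<in> V" for x y
    using hs0 that by blast
  have fin': "finite A'" "finite B'" "finite C'"
    using sub finV by (auto intro: finite_subset)
  \<comment> \<open>The switching weights cancel in \<open>h x y * h y x\<close>, so the trace of
    the square counts the edges between the recovered parts.\<close>
  have "(\<Sum>x\<in>V. \<Sum>y\<in>V. h x y * h y x) =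
      (\<Sum>x\<in>V. \<Sum>y\<in>V. hermitian_entry (cyclic_tripartite A' B' C') x y * hermitian_entry (cyclic_tripartite A' B' C') y x)"
  proof (intro sum.cong refl)
    fix x y assume xy: "x \<in> V" "y \<in> V"
    have "s x * cnj (s x) = 1" "s y * cnj (s y) = 1"
      using s[OF xy(1)] s[OF xy(2)] by auto
    moreover have "h x y * h y x = (s x * cnj (s x)) * (s y * cnj (s y)) * (hermitian_entry (cyclic_tripartite A' B' C') x y
        * hermitian_entry (cyclic_tripartite A' B' C') y x)"
      unfolding hs[OF xy] hs[OF xy(2,1)] by (simp only: mult_ac)
    ultimately show "h x y * h y x = hermitian_entry (cyclic_tripartite A' B' C') x y
        * hermitian_entry (cyclic_tripartite A' B' C') y x"
      by simp
  qed
  then have "2 * complex_of_nat (card A' * card B' + card B' * card C' + card C' * card A') = 2 * of_nat m"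
    using tr2' cyclic_tripartite_edge_sum[OF fin' disj' finV sub] by simp
  then have edges': "card A' * card B' + card B' * card C' + card C' * card A' = m"
    by (simp del: of_nat_add of_nat_mult)
  have cards': "card A' + card B' + card C' = card (A' \<union> B' \<union> C')"
    using card_disjoint_parts[OF fin' disj'] by simp
  then have "card A' + card B' + card C' \<le> 2 * k + l"
    using card_mono[OF finV sub] cardV N by simp
  then have parts: "(card A', card B', card C') \<in> {(k, k, l), (k, l, k), (l, k, k)}"
    using balanced_parts[OF kl] edges' unfolding m_def by blast
  \<comment> \<open>The parts already have \<open>N\<close> elements together, so no vertex is
    isolated.\<close>
  then have VABC: "V = A' \<union> B' \<union> C'"
    using cards' cardV N card_subset_eq[OF finV sub] by auto
  have rot: "cyclic_tripartite B' C' A' = cyclic_tripartite A' B' C'"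
    "cyclic_tripartite C' A' B' = cyclic_tripartite A' B' C'"
    by (auto simp: cyclic_tripartite_def)
  \<comment> \<open>The possible size triples are exactly the rotations of \<open>(k, k, l)\<close>,
    and rotating the parts does not change the graph. Relabelled parts therefore match
    \<open>A, B, C\<close> in size.\<close>
  obtain A1 B1 C1 where 1: "V = A1 \<union> B1 \<union> C1" "finite A1" "finite B1" "finite C1"
      "A1 \<inter> B1 = {}" "B1 \<inter> C1 = {}" "C1 \<inter> A1 = {}" "card A1 = card A" "card B1 = card B" "card C1 = card C"
      "cyclic_tripartite A1 B1 C1 = cyclic_tripartite A' B' C'"
  proof -
    consider "card A' = k" "card B' = k" "card C' = l" | "card C' = k" "card A' = k" "card B' = l"
      | "card B' = k" "card C' = k" "card A' = l"
      using parts by auto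
    then show thesis
    proof cases
      case 1 then show thesis using that[of A' B' C'] VABC fin' disj' card by simp
    next
      case 2 then show thesis using that[of C' A' B'] VABC fin' disj' card rot by auto
    next
      case 3 then show thesis using that[of B' C' A'] VABC fin' disj' card rot by auto
    qed
  qed
  obtain f where f: "bij_betw f V (A \<union> B \<union> C)" "f ` A1 = A" "f ` B1 = B" "f ` C1 = C"
    using bij_betw_parts[OF fin 1(2-4) disj 1(5-10)] 1(1) by auto
  have mem: "f x \<in> A \<longleftrightarrow> x \<in> A1" "f x \<in> B \<longleftrightarrow> x \<in> B1" "f x \<in> C \<longleftrightarrow> x \<in> C1" if "x \<in> V" for x
    using that f 1(1) disj by blast+
  have "hermitian_entry D' x y = s x * cnj (s y) * hermitian_entry ?D (f x) (f y)" if "x \<in> V" "y \<in> V" for x y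
  proof -
    have "hermitian_entry ?D (f x) (f y) = hermitian_entry (cyclic_tripartite A1 B1 C1) x y"
      unfolding hermitian_entry_cyclic_tripartite[OF disj] hermitian_entry_cyclic_tripartite[OF 1(5-7)]
      by (simp only: mem[OF that(1)] mem[OF that(2)])
    then show ?thesis
      using hs[OF that] by (simp add: h_def 1(11))
  qed
  then have "\<exists>D''. four_way_switching ?D D'' \<and> isomorphic D' D''"
    using f(1) s by (intro switched_copy[OF D D', of f s]) (auto simp: V_def VD)
  then show "\<exists>D''. four_way_switching ?D D'' \<and> (isomorphic D' D'' \<or> isomorphic D' (reversal D''))"
    by blast
qed

lemma is_C3_DHS:
  assumes "is_C3 k k l D" "k \<ge> 1" "l \<ge> 1" "\<bar>int k - int l\<bar> \<le> 1"
  shows "DHS TYPE('b) D"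
  using assms cyclic_tripartite_DHS unfolding is_C3_def cyclic_tripartite_def by blast

lemma is_C3_rotate:
  assumes "is_C3 a b c D"
  shows "is_C3 b c a D"
proof -
  obtain A B C where "finite A" "finite B" "finite C" "A \<inter> B = {}" "B \<inter> C = {}" "C \<inter> A = {}"
    "card A = a" "card B = b" "card C = c"
    "D = \<lparr>verts = A \<union> B \<union> C, edges = {}, arcs = A \<times> B \<union> B \<times> C \<union> C \<times> A\<rparr>"
    using assms unfolding is_C3_def by blast
  then show ?thesis
    unfolding is_C3_def by (intro exI[of _ B] exI[of _ C] exI[of _ A]) auto
qed

theorem corollary5p12:
  shows "(\<forall>n \<ge> 1. \<forall>D :: 'a mixed_graph. is_C3 n n n D \<longrightarrow> DHS TYPE('b) D) \<and>
         (\<forall>n \<ge> 1. \<forall>D :: 'a mixed_graph. is_C3 n n (n + 1) D \<longrightarrow> DHS TYPE('b) D) \<and>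
         (\<forall>n \<ge> 2. \<forall>D :: 'a mixed_graph. is_C3 (n - 1) n n D \<longrightarrow> DHS TYPE('b) D)"
proof (intro conjI allI impI)
  fix n :: nat and D :: "'a mixed_graph"
  show "DHS TYPE('b) D" if "1 \<le> n" "is_C3 n n n D"
    using that by (intro is_C3_DHS[of n n]) auto
  show "DHS TYPE('b) D" if "1 \<le> n" "is_C3 n n (n + 1) D"
    using that by (intro is_C3_DHS[of n "n + 1"]) auto
  \<comment> \<open>Rotation turns the sizes \<open>n - 1, n, n\<close> into
    \<open>n, n, n - 1\<close>; the bound on \<open>n\<close> keeps the third part nonempty.\<close>
  show "DHS TYPE('b) D" if "2 \<le> n" "is_C3 (n - 1) n n D"
    using that is_C3_rotate[of "n - 1" n n D] by (intro is_C3_DHS[of n "n - 1"]) auto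
qed

end
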